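(* Let $p$ be a prime, let $m,n\ge 2$ be integers, and let $\mathbf{a}_q,\mathbf{b}_q\in\mathbb{Z}_p$ satisfy $0\le_{comp}\mathbf{a}_q<_{comp}\mathbf{b}_q$. Let $[\mathbf{a}_q]_{\mathbf{b}_q}=\{\mathbf{a}_q+\mathbf{b}_q\mathbf{k}\mid \mathbf{k}\in\mathbb{Z}_p\}\subseteq\mathbb{Z}_p$ be the $p$-adic analog of the residue class of $\mathbf{a}_q$ modulo $\mathbf{b}_q$. Suppose that $$m\,\mathbf{a}_q=\mathbf{a}_q\ (\operatorname{Mod}_p\mathbf{b}_q),\qquad \mathbf{a}_q^{\,n}=\mathbf{a}_q\ (\operatorname{Mod}_p\mathbf{b}_q).$$ Then $[\mathbf{a}_q]_{\mathbf{b}_q}$ is an $(m,n)$-ring with respect to the $m$-ary addition $$\nu_m[\mathbf{r}_1,\ldots,\mathbf{r}_m]=\mathbf{r}_1+\mathbf{r}_2+\cdots+\mathbf{r}_m$$ and the $n$-ary multiplication $$\mu_n[\mathbf{r}_1,\ldots,\mathbf{r}_n]=\mathbf{r}_1\mathbf{r}_2\cdots\mathbf{r}_n ,$$ where $\mathbf{r}_i\in[\mathbf{a}_q]_{\mathbf{b}_q}$ and the sums and products on the right are taken in $\mathbb{Z}_p$.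
   Context: $\mathbb{Z}_p$ is the ring of $p$-adic integers; every $\mathbf{x}\in\mathbb{Z}_p$ has a unique standard expansion $\mathbf{x}=\sum_{i\ge 0}\alpha_i p^i$ with digits $\alpha_i\in\{0,1,\ldots,p-1\}$. Componentwise order: for $\mathbf{a}=\sum_i\alpha_ip^i$ and $\mathbf{b}=\sum_i\beta_ip^i$ in standard expansion, $\mathbf{a}<_{comp}\mathbf{b}$ means $\alpha_i<\beta_i$ for all $i\ge 0$, and $\mathbf{a}\le_{comp}\mathbf{b}$ means $\alpha_i\le\beta_i$ for all $i\ge0$. For $\mathbf{r},\mathbf{a},\mathbf{b}\in\mathbb{Z}_p$, the notation $\mathbf{r}=\mathbf{a}\ (\operatorname{Mod}_p\mathbf{b})$ means that $\mathbf{r}=\mathbf{a}+\mathbf{b}\mathbf{k}$ for some $\mathbf{k}\in\mathbb{Z}_p$. Polyadic structures (for $m,n\ge2$): An $n$-ary semigroup $\langle S\mid\mu\rangle$ is a nonempty set $S$ with a (closed) operation $\mu:S^n\to S$ that is totally associative, i.e. $\mu[x_1,\ldots,x_i,\mu[x_{i+1},\ldots,x_{i+n}],x_{i+n+1},\ldots,x_{2n-1}]$ is independent of $i\in\{0,\ldots,n-1\}$ for all $x_1,\ldots,x_{2n-1}\in S$. It is commutative if $\mu$ is invariant under all permutations of its arguments. An $m$-ary group is an $m$-ary semigroup $\langle G\mid\nu\rangle$ in which, for each position $i$ and all $x_1,\ldots,x_{i-1},x_{i+1},\ldots,x_m,y\in G$, the equation $\nu[x_1,\ldots,x_{i-1},z,x_{i+1},\ldots,x_m]=y$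 has a unique solution $z\in G$. An $(m,n)$-ring $\langle R\mid\nu_m,\mu_n\rangle$ is a set $R$ such that $\langle R\mid\nu_m\rangle$ is a commutative $m$-ary group, $\langle R\mid\mu_n\rangle$ is an $n$-ary semigroup, and $\mu_n$ distributes over $\nu_m$ in each argument: $\mu_n[x_1,\ldots,x_{i-1},\nu_m[y_1,\ldots,y_m],x_{i+1},\ldots,x_n]=\nu_m[\mu_n[x_1,\ldots,x_{i-1},y_1,x_{i+1},\ldots,x_n],\ldots,\mu_n[x_1,\ldots,x_{i-1},y_m,x_{i+1},\ldots,x_n]]$. *)

theory Defs
  imports "HOL-Algebra.Ring" "HOL-Computational_Algebra.Primes" "HOL-Library.Multiset"
begin

section \<open>The ring of p-adic integers\<close>

text \<open>
  The p-adic integers are constructed as the inverse limit of the rings of integers modulo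
  \<open>p ^ k\<close>: an element is a sequence \<open>x\<close> whose entry \<open>x k\<close> is the canonical representative, in
  \<open>{0..<p ^ k}\<close>, of its residue modulo \<open>p ^ k\<close>. Only the case of a prime \<open>p\<close> is of interest.
\<close>

definition padic_int :: "nat \<Rightarrow> (nat \<Rightarrow> int) ring" where
  "padic_int p =
    \<lparr>carrier = {x. \<forall>k. x k \<in> {0..<int p ^ k} \<and> x (Suc k) mod int p ^ k = x k},
     monoid.mult = (\<lambda>x y k. (x k * y k) mod int p ^ k),
     one = (\<lambda>k. 1 mod int p ^ k),
     ring.zero = (\<lambda>k. 0),
     ring.add = (\<lambda>x y k. (x k + y k) mod int p ^ k)\<rparr>"

text \<open>
  Convergence of the series of the \<open>\<alpha> i * p ^ i\<close> to \<open>x\<close> is expressed by requiring that the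
  \<open>k\<close>-th partial sum agrees with \<open>x\<close> modulo \<open>p ^ k\<close>, for every \<open>k\<close>.
\<close>

definition standard_expansion :: "nat \<Rightarrow> (nat \<Rightarrow> int) \<Rightarrow> (nat \<Rightarrow> int) \<Rightarrow> bool" where
  "standard_expansion p x \<alpha> \<longleftrightarrow>
    (\<forall>i. \<alpha> i \<in> {0..int p - 1}) \<and>
    (\<forall>k. x k = (\<Sum>i<k. \<alpha> i * int p ^ i) mod int p ^ k)"

definition padic_digits :: "nat \<Rightarrow> (nat \<Rightarrow> int) \<Rightarrow> nat \<Rightarrow> int" where
  "padic_digits p x = (THE \<alpha>. standard_expansion p x \<alpha>)"

definition comp_less :: "nat \<Rightarrow> (nat \<Rightarrow> int) \<Rightarrow> (nat \<Rightarrow> int) \<Rightarrow> bool" where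
  "comp_less p a b \<longleftrightarrow> (\<forall>i. padic_digits p a i < padic_digits p b i)"

definition comp_le :: "nat \<Rightarrow> (nat \<Rightarrow> int) \<Rightarrow> (nat \<Rightarrow> int) \<Rightarrow> bool" where
  "comp_le p a b \<longleftrightarrow> (\<forall>i. padic_digits p a i \<le> padic_digits p b i)"

text \<open>The relation written \<open>r = a (Mod\<^sub>p b)\<close>.\<close>

definition padic_mod_eq :: "nat \<Rightarrow> (nat \<Rightarrow> int) \<Rightarrow> (nat \<Rightarrow> int) \<Rightarrow> (nat \<Rightarrow> int) \<Rightarrow> bool" where
  "padic_mod_eq p r a b \<longleftrightarrow>
    (\<exists>k\<in>carrier (padic_int p).
      r = a \<oplus>\<^bsub>padic_int p\<^esub> (b \<otimes>\<^bsub>padic_int p\<^esub> k))"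

definition padic_residue_class :: "nat \<Rightarrow> (nat \<Rightarrow> int) \<Rightarrow> (nat \<Rightarrow> int) \<Rightarrow> (nat \<Rightarrow> int) set" where
  "padic_residue_class p a b =
    {a \<oplus>\<^bsub>padic_int p\<^esub> (b \<otimes>\<^bsub>padic_int p\<^esub> k) | k. k \<in> carrier (padic_int p)}"


section \<open>Polyadic structures\<close>

text \<open>
  An \<open>n\<close>-ary operation is a function on lists, of which only the values on lists of length \<open>n\<close>
  with entries in the underlying set matter.
\<close>

definition nary_closed :: "nat \<Rightarrow> 'a set \<Rightarrow> ('a list \<Rightarrow> 'a) \<Rightarrow> bool" where
  "nary_closed n S f \<longleftrightarrow> (\<forall>xs. length xs = n \<and> set xs \<subseteq> S \<longrightarrow> f xs \<in> S)"

definition totally_associative :: "nat \<Rightarrow> 'a set \<Rightarrow> ('a list \<Rightarrow> 'a) \<Rightarrow> bool" where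
  "totally_associative n S f \<longleftrightarrow>
    (\<forall>xs. length xs = 2 * n - 1 \<and> set xs \<subseteq> S \<longrightarrow>
      (\<forall>i<n. \<forall>j<n.
        f (take i xs @ f (take n (drop i xs)) # drop (i + n) xs) =
        f (take j xs @ f (take n (drop j xs)) # drop (j + n) xs)))"

definition nary_semigroup :: "nat \<Rightarrow> 'a set \<Rightarrow> ('a list \<Rightarrow> 'a) \<Rightarrow> bool" where
  "nary_semigroup n S f \<longleftrightarrow>
    n \<ge> 2 \<and> S \<noteq> {} \<and> nary_closed n S f \<and> totally_associative n S f"

definition nary_commutative :: "nat \<Rightarrow> 'a set \<Rightarrow> ('a list \<Rightarrow> 'a) \<Rightarrow> bool" where
  "nary_commutative n S f \<longleftrightarrow>
    (\<forall>xs ys. length xs = n \<and> set xs \<subseteq> S \<and> mset ys = mset xs \<longrightarrow> f ys = f xs)"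

definition nary_group :: "nat \<Rightarrow> 'a set \<Rightarrow> ('a list \<Rightarrow> 'a) \<Rightarrow> bool" where
  "nary_group m G f \<longleftrightarrow>
    nary_semigroup m G f \<and>
    (\<forall>us vs y. length us + 1 + length vs = m \<and> set us \<subseteq> G \<and> set vs \<subseteq> G \<and> y \<in> G \<longrightarrow>
      (\<exists>!z. z \<in> G \<and> f (us @ z # vs) = y))"

definition polyadic_distributive ::
  "nat \<Rightarrow> nat \<Rightarrow> 'a set \<Rightarrow> ('a list \<Rightarrow> 'a) \<Rightarrow> ('a list \<Rightarrow> 'a) \<Rightarrow> bool" where
  "polyadic_distributive m n R \<nu> \<mu> \<longleftrightarrow>
    (\<forall>us vs ys. length us + 1 + length vs = n \<and> set us \<subseteq> R \<and> set vs \<subseteq> R \<and>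
        length ys = m \<and> set ys \<subseteq> R \<longrightarrow>
      \<mu> (us @ \<nu> ys # vs) = \<nu> (map (\<lambda>y. \<mu> (us @ y # vs)) ys))"

definition polyadic_ring ::
  "nat \<Rightarrow> nat \<Rightarrow> 'a set \<Rightarrow> ('a list \<Rightarrow> 'a) \<Rightarrow> ('a list \<Rightarrow> 'a) \<Rightarrow> bool" where
  "polyadic_ring m n R \<nu> \<mu> \<longleftrightarrow>
    nary_group m R \<nu> \<and> nary_commutative m R \<nu> \<and>
    nary_semigroup n R \<mu> \<and> polyadic_distributive m n R \<nu> \<mu>"

definition padic_sum :: "nat \<Rightarrow> (nat \<Rightarrow> int) list \<Rightarrow> (nat \<Rightarrow> int)" where
  "padic_sum p rs = foldr (\<lambda>x y. x \<oplus>\<^bsub>padic_int p\<^esub> y) rs \<zero>\<^bsub>padic_int p\<^esub>"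

definition padic_prod :: "nat \<Rightarrow> (nat \<Rightarrow> int) list \<Rightarrow> (nat \<Rightarrow> int)" where
  "padic_prod p rs = foldr (\<lambda>x y. x \<otimes>\<^bsub>padic_int p\<^esub> y) rs \<one>\<^bsub>padic_int p\<^esub>"


section \<open>Basic facts on p-adic integers\<close>

lemma padic_carrier_iff:
  "x \<in> carrier (padic_int p) \<longleftrightarrow>
    (\<forall>k. 0 \<le> x k \<and> x k < int p ^ k \<and> x (Suc k) mod int p ^ k = x k)"
  by (auto simp: padic_int_def)

lemma padic_carrierI:
  assumes "p > 0" "\<And>k. g (Suc k) mod int p ^ k = g k mod int p ^ k"
  shows "(\<lambda>k. g k mod int p ^ k) \<in> carrier (padic_int p)"
proof -
  have "(g (Suc k) mod int p ^ Suc k) mod int p ^ k = g k mod int p ^ k" for k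
    using assms(2)[of k] by (simp add: mod_mod_cancel del: power_Suc add: le_imp_power_dvd)
  with \<open>p > 0\<close> show ?thesis unfolding padic_carrier_iff by simp
qed

lemma cring_padic_int:
  assumes "p > 0"
  shows "cring (padic_int p)"
proof -
  let ?Z = "padic_int p"
  have add: "x \<oplus>\<^bsub>?Z\<^esub> y = (\<lambda>k. (x k + y k) mod int p ^ k)" for x y
    by (simp add: padic_int_def)
  have mult: "x \<otimes>\<^bsub>?Z\<^esub> y = (\<lambda>k. (x k * y k) mod int p ^ k)" for x y
    by (simp add: padic_int_def)
  have zero: "\<zero>\<^bsub>?Z\<^esub> = (\<lambda>k. 0)" and one: "\<one>\<^bsub>?Z\<^esub> = (\<lambda>k. 1 mod int p ^ k)"
    by (simp_all add: padic_int_def)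
  have step: "x (Suc k) mod int p ^ k = x k" and small: "x k mod int p ^ k = x k"
    if "x \<in> carrier ?Z" for x k
    using that unfolding padic_carrier_iff by simp_all
  have closed_add: "x \<oplus>\<^bsub>?Z\<^esub> y \<in> carrier ?Z"
    if "x \<in> carrier ?Z" "y \<in> carrier ?Z" for x y
    unfolding add
    by (rule padic_carrierI[OF assms]) (metis mod_add_eq step that)
  have closed_mult: "x \<otimes>\<^bsub>?Z\<^esub> y \<in> carrier ?Z"
    if "x \<in> carrier ?Z" "y \<in> carrier ?Z" for x y
    unfolding mult
    by (rule padic_carrierI[OF assms]) (metis mod_mult_eq step that)
  have closed_zero: "\<zero>\<^bsub>?Z\<^esub> \<in> carrier ?Z"
    using assms unfolding padic_carrier_iff zero by simp
  have closed_one: "\<one>\<^bsub>?Z\<^esub> \<in> carrier ?Z"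
    unfolding one by (rule padic_carrierI[OF assms]) simp
  have inverse: "\<exists>y\<in>carrier ?Z. y \<oplus>\<^bsub>?Z\<^esub> x = \<zero>\<^bsub>?Z\<^esub>" if x: "x \<in> carrier ?Z" for x
  proof (rule bexI)
    show "(\<lambda>k. (- x k) mod int p ^ k) \<in> carrier ?Z"
      by (rule padic_carrierI[OF assms]) (metis mod_minus_eq step x)
    show "(\<lambda>k. (- x k) mod int p ^ k) \<oplus>\<^bsub>?Z\<^esub> x = \<zero>\<^bsub>?Z\<^esub>"
      by (simp add: add zero mod_add_left_eq)
  qed
  show ?thesis
  proof (rule cringI)
    show "abelian_group ?Z"
    proof (rule abelian_groupI)
      show "(x \<oplus>\<^bsub>?Z\<^esub> y) \<oplus>\<^bsub>?Z\<^esub> z = x \<oplus>\<^bsub>?Z\<^esub> (y \<oplus>\<^bsub>?Z\<^esub> z)" for x y z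
        by (simp add: add mod_add_left_eq mod_add_right_eq add.assoc)
      show "x \<oplus>\<^bsub>?Z\<^esub> y = y \<oplus>\<^bsub>?Z\<^esub> x" for x y by (simp add: add add.commute)
      show "\<zero>\<^bsub>?Z\<^esub> \<oplus>\<^bsub>?Z\<^esub> x = x" if "x \<in> carrier ?Z" for x
        using small[OF that] by (simp add: add zero)
    qed (fact closed_add closed_zero inverse)+
    show "comm_monoid ?Z"
    proof (rule comm_monoidI)
      show "(x \<otimes>\<^bsub>?Z\<^esub> y) \<otimes>\<^bsub>?Z\<^esub> z = x \<otimes>\<^bsub>?Z\<^esub> (y \<otimes>\<^bsub>?Z\<^esub> z)" for x y z
        by (simp add: mult mod_mult_left_eq mod_mult_right_eq mult.assoc)
      show "x \<otimes>\<^bsub>?Z\<^esub> y = y \<otimes>\<^bsub>?Z\<^esub> x" for x y by (simp add: mult mult.commute)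
      show "\<one>\<^bsub>?Z\<^esub> \<otimes>\<^bsub>?Z\<^esub> x = x" if "x \<in> carrier ?Z" for x
        using small[OF that] by (simp add: mult one mod_mult_left_eq)
    qed (fact closed_mult closed_one)+
    show "(x \<oplus>\<^bsub>?Z\<^esub> y) \<otimes>\<^bsub>?Z\<^esub> z = x \<otimes>\<^bsub>?Z\<^esub> z \<oplus>\<^bsub>?Z\<^esub> y \<otimes>\<^bsub>?Z\<^esub> z" for x y z
      by (simp add: add mult mod_mult_left_eq mod_add_eq distrib_right)
  qed
qed

lemma digit_sum_bounds:
  assumes "\<And>i. (\<alpha> i :: int) \<in> {0..int p - 1}"
  shows "(\<Sum>i<k. \<alpha> i * int p ^ i) \<in> {0..<int p ^ k}"
proof (induction k)
  case (Suc k)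
  have "\<alpha> k * int p ^ k \<le> (int p - 1) * int p ^ k" "0 \<le> \<alpha> k * int p ^ k"
    using assms[of k] by (auto intro: mult_right_mono)
  with Suc show ?case by (auto simp: algebra_simps)
qed simp

lemma standard_expansion_ex1:
  assumes "p > 0" and x: "x \<in> carrier (padic_int p)"
  shows "\<exists>!\<alpha>. standard_expansion p x \<alpha>"
proof (rule ex1I)
  let ?\<alpha> = "\<lambda>i. x (Suc i) div int p ^ i"
  have pos: "int p ^ k > 0" for k using assms by simp
  have digit: "?\<alpha> i \<in> {0..int p - 1}" for i
  proof -
    have bounds: "0 \<le> x (Suc i)" "x (Suc i) < int p * int p ^ i"
      using x unfolding padic_carrier_iff by (simp, metis power_Suc)
    have "x (Suc i) div int p ^ i < int p"
    proof (rule ccontr)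
      assume "\<not> x (Suc i) div int p ^ i < int p"
      then have "int p * int p ^ i \<le> (x (Suc i) div int p ^ i) * int p ^ i"
        using pos[of i] by (intro mult_right_mono) auto
      also have "\<dots> \<le> x (Suc i)"
        using pos[of i] by (simp add: minus_mod_eq_div_mult [symmetric])
      finally show False using bounds by simp
    qed
    with bounds pos[of i] show ?thesis
      by (simp add: pos_imp_zdiv_nonneg_iff)
  qed
  have partial: "(\<Sum>i<k. ?\<alpha> i * int p ^ i) = x k" for k
  proof (induction k)
    case 0
    have "0 \<le> x 0 \<and> x 0 < int p ^ 0" using x unfolding padic_carrier_iff by blast
    then show ?case by simp
  next
    case (Suc k)
    have "x (Suc k) mod int p ^ k = x k" using x unfolding padic_carrier_iff by blast
    with Suc show ?case
      using mod_div_mult_eq[of "x (Suc k)" "int p ^ k"] by simp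
  qed
  show "standard_expansion p x ?\<alpha>"
    unfolding standard_expansion_def partial
    using digit x by (simp add: padic_carrier_iff)
  fix \<beta> assume "standard_expansion p x \<beta>"
  then have \<beta>: "\<beta> i \<in> {0..int p - 1}" "x k = (\<Sum>i<k. \<beta> i * int p ^ i) mod int p ^ k" for i k
    unfolding standard_expansion_def by blast+
  have sum_\<beta>: "x k = (\<Sum>i<k. \<beta> i * int p ^ i)" for k
    using \<beta>(2)[of k] digit_sum_bounds[of \<beta> p k, OF \<beta>(1)] by simp
  show "\<beta> = ?\<alpha>"
  proof
    fix i
    have "\<beta> i * int p ^ i = ?\<alpha> i * int p ^ i"
      using sum_\<beta>[of "Suc i"] sum_\<beta>[of i] partial[of "Suc i"] partial[of i]
      unfolding sum.lessThan_Suc by linarith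
    then show "\<beta> i = ?\<alpha> i" using pos[of i] assms by auto
  qed
qed

lemma standard_expansion_padic_digits:
  assumes "p > 0" "x \<in> carrier (padic_int p)"
  shows "standard_expansion p x (padic_digits p x)"
  unfolding padic_digits_def by (rule theI'[OF standard_expansion_ex1[OF assms]])

end

theory Submission
  imports Defs "HOL-Algebra.Divisibility" "HOL-Algebra.QuotRing"
begin

(* "prime" is to mean a prime number, not a prime element of a monoid *)
hide_const (open) Divisibility.prime

text \<open>
  A residue class of \<open>a\<close> modulo \<open>b\<close> is a fibre of a ring homomorphism, namely of the projection
  \<open>h\<close> onto the quotient by the principal ideal of \<open>b\<close>. The two congruences say that
  \<open>e = h a\<close> satisfies \<open>m \<cdot> e = e\<close> and \<open>e ^ n = e\<close>, so that sums of \<open>m\<close> elements and products of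
  \<open>n\<close> elements of the fibre over \<open>e\<close> stay in it: this is the closedness of the two operations.
  Total associativity, commutativity and distributivity are inherited from the ambient
  commutative ring, as both operations are iterated binary ones.

  The substantial point is that the equation \<open>\<Sum>us + z + \<Sum>vs = y\<close>, which has just one solution in
  the ambient ring, is solved inside the fibre. Applying \<open>h\<close> gives \<open>i \<cdot> e + h z + j \<cdot> e = e\<close> with
  \<open>i + 1 + j = m\<close>, whereas \<open>i \<cdot> e + e + j \<cdot> e = m \<cdot> e = e\<close>; cancelling, \<open>h z = e\<close>.

  The part that concerns a single operation is proved for homomorphisms of (multiplicative)
  monoids and groups (\<open>fibre_nary_semigroup\<close>, \<open>fibre_nary_group\<close>), and is applied both to the
  multiplication and to the addition of the ring in \<open>fibre_polyadic_ring\<close>. The ambient ring may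
  be any commutative ring; the \<open>p\<close>-adic integers enter only as an instance.
\<close>

section \<open>Iterated products in a monoid\<close>

abbreviation (input) list_mult :: "('a, 'b) monoid_scheme \<Rightarrow> 'a list \<Rightarrow> 'a" where
  "list_mult G xs \<equiv> foldr (\<otimes>\<^bsub>G\<^esub>) xs \<one>\<^bsub>G\<^esub>"

context monoid
begin

lemma list_mult_append:
  assumes "set xs \<subseteq> carrier G" "set ys \<subseteq> carrier G"
  shows "list_mult G (xs @ ys) = list_mult G xs \<otimes> list_mult G ys"
  using assms by (induction xs) (simp_all add: m_assoc)

text \<open>However a product of \<open>2n - 1\<close> factors is bracketed, it equals the unbracketed product.\<close>

lemma totally_associative_list_mult:
  assumes "S \<subseteq> carrier G"
  shows "totally_associative n S (list_mult G)"
proof -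
  have "list_mult G (take i xs @ list_mult G (take n (drop i xs)) # drop (i + n) xs)
      = list_mult G xs" if "set xs \<subseteq> S" for xs i
  proof -
    have split: "xs = take i xs @ take n (drop i xs) @ drop (i + n) xs"
      by (metis add.commute append_take_drop_id drop_drop)
    have sub: "set (take i xs) \<subseteq> carrier G" "set (take n (drop i xs)) \<subseteq> carrier G"
        "set (drop (i + n) xs) \<subseteq> carrier G"
      using that assms by (meson order_trans set_take_subset set_drop_subset)+
    have "list_mult G xs = list_mult G (take i xs) \<otimes>
        (list_mult G (take n (drop i xs)) \<otimes> list_mult G (drop (i + n) xs))"
      using sub by (subst split) (simp add: list_mult_append del: append_take_drop_id foldr_append)
    then show ?thesis
      using sub by (simp add: list_mult_append del: foldr_append)
  qed
  then show ?thesis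
    unfolding totally_associative_def by simp
qed

end

lemma (in comm_monoid) nary_commutative_list_mult:
  assumes "S \<subseteq> carrier G"
  shows "nary_commutative n S (list_mult G)"
  unfolding nary_commutative_def
  using assms by (metis multlist_perm_cong order_trans set_mset_mset)


section \<open>Fibres of homomorphisms of monoids and groups\<close>

abbreviation (input) fibre :: "('a, 'c) monoid_scheme \<Rightarrow> ('a \<Rightarrow> 'b) \<Rightarrow> 'a \<Rightarrow> 'a set" where
  "fibre G h a \<equiv> {x \<in> carrier G. h x = h a}"

lemma hom_list_mult_fibre:
  assumes "monoid G" "h \<in> hom G H" and a: "a \<in> carrier G" and "set xs \<subseteq> fibre G h a"
  shows "h (list_mult G xs) = h (a [^]\<^bsub>G\<^esub> length xs)"
  using assms(4)
proof (induction xs)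
  case (Cons x xs)
  interpret monoid G by fact
  have "set xs \<subseteq> carrier G" "x \<in> carrier G" "h x = h a"
    using Cons.prems by auto
  then have "h (list_mult G (x # xs)) = h (a \<otimes>\<^bsub>G\<^esub> a [^]\<^bsub>G\<^esub> length xs)"
    using Cons a hom_mult[OF assms(2)] by simp
  also have "a \<otimes>\<^bsub>G\<^esub> a [^]\<^bsub>G\<^esub> length xs = a [^]\<^bsub>G\<^esub> length (x # xs)"
    by (simp only: list.size add_0_right add_Suc_right nat_pow_Suc2[OF a])
  finally show ?case .
qed (simp add: nat_pow_def)

lemma fibre_nary_semigroup:
  assumes "monoid G" "h \<in> hom G H" "a \<in> carrier G" "n \<ge> 2"
    and "h (a [^]\<^bsub>G\<^esub> n) = h a"
  shows "nary_semigroup n (fibre G h a) (list_mult G)"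
proof -
  interpret monoid G by fact
  have "list_mult G xs \<in> fibre G h a" if "length xs = n" "set xs \<subseteq> fibre G h a" for xs
    using that hom_list_mult_fibre[OF assms(1-3) that(2)] assms(5) by auto
  moreover have "totally_associative n (fibre G h a) (list_mult G)"
    by (rule totally_associative_list_mult) auto
  ultimately show ?thesis
    using assms(3,4) unfolding nary_semigroup_def nary_closed_def by blast
qed

text \<open>
  In \<open>us\<cdot>z\<cdot>vs = y\<close> the image of \<open>z\<close> is determined by the images of the other terms, and these are
  unchanged when \<open>us\<close>, \<open>vs\<close> and \<open>y\<close> are replaced by powers of \<open>a\<close>; as \<open>z = a\<close> then solves the
  equation after applying \<open>h\<close>, every solution lies in the fibre of \<open>a\<close>.
\<close>

lemma fibre_nary_group:
  assumes "group_hom G H h" and a: "a \<in> carrier G" and "n \<ge> 2"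
    and pow: "h (a [^]\<^bsub>G\<^esub> n) = h a"
  shows "nary_group n (fibre G h a) (list_mult G)"
proof -
  interpret group_hom G H h by fact
  have "\<exists>!z. z \<in> fibre G h a \<and> list_mult G (us @ z # vs) = y"
    if len: "length us + 1 + length vs = n"
      and us: "set us \<subseteq> fibre G h a" and vs: "set vs \<subseteq> fibre G h a" and y: "y \<in> fibre G h a"
    for us vs y
  proof -
    define U V where "U = list_mult G us" and "V = list_mult G vs"
    have sub: "set us \<subseteq> carrier G" "set vs \<subseteq> carrier G"
      using us vs by auto
    then have UV: "U \<in> carrier G" "V \<in> carrier G"
      unfolding U_def V_def by simp_all
    have hUV: "h U = h (a [^]\<^bsub>G\<^esub> length us)" "h V = h (a [^]\<^bsub>G\<^esub> length vs)"
      unfolding U_def V_def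
      using hom_list_mult_fibre[OF G.is_monoid homh a] us vs by simp_all
    have eq: "list_mult G (us @ z # vs) = U \<otimes>\<^bsub>G\<^esub> (z \<otimes>\<^bsub>G\<^esub> V)" if "z \<in> carrier G" for z
      unfolding U_def V_def using sub that by (simp add: G.list_mult_append del: foldr_append)
    have "a [^]\<^bsub>G\<^esub> n = a [^]\<^bsub>G\<^esub> length us \<otimes>\<^bsub>G\<^esub> (a \<otimes>\<^bsub>G\<^esub> a [^]\<^bsub>G\<^esub> length vs)"
      unfolding len[symmetric] G.nat_pow_mult[OF a, symmetric] using a by (simp add: G.m_assoc)
    with pow have "h a = h (a [^]\<^bsub>G\<^esub> length us \<otimes>\<^bsub>G\<^esub> (a \<otimes>\<^bsub>G\<^esub> a [^]\<^bsub>G\<^esub> length vs))"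
      by simp
    also have "\<dots> = h U \<otimes>\<^bsub>H\<^esub> (h a \<otimes>\<^bsub>H\<^esub> h V)"
      unfolding hUV using a by (simp only: hom_mult G.m_closed G.nat_pow_closed)
    finally have ha: "h a = h U \<otimes>\<^bsub>H\<^esub> (h a \<otimes>\<^bsub>H\<^esub> h V)" .
    define z where "z = inv\<^bsub>G\<^esub> U \<otimes>\<^bsub>G\<^esub> y \<otimes>\<^bsub>G\<^esub> inv\<^bsub>G\<^esub> V"
    have z: "z \<in> carrier G"
      unfolding z_def using UV y by simp
    have "z \<otimes>\<^bsub>G\<^esub> V = inv\<^bsub>G\<^esub> U \<otimes>\<^bsub>G\<^esub> y"
      unfolding z_def using UV y by (simp add: G.m_assoc)
    then have yz: "U \<otimes>\<^bsub>G\<^esub> (z \<otimes>\<^bsub>G\<^esub> V) = y"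
      using UV y by (simp flip: G.m_assoc)
    have "h U \<otimes>\<^bsub>H\<^esub> (h z \<otimes>\<^bsub>H\<^esub> h V) = h (U \<otimes>\<^bsub>G\<^esub> (z \<otimes>\<^bsub>G\<^esub> V))"
      using z UV by simp
    also have "\<dots> = h a"
      using yz y by simp
    also note ha
    finally have "h U \<otimes>\<^bsub>H\<^esub> (h z \<otimes>\<^bsub>H\<^esub> h V) = h U \<otimes>\<^bsub>H\<^esub> (h a \<otimes>\<^bsub>H\<^esub> h V)" .
    then have "h z = h a"
      using z a UV by simp
    show ?thesis
    proof (rule ex1I[of _ z])
      show "z \<in> fibre G h a \<and> list_mult G (us @ z # vs) = y"
        unfolding eq[OF z] using z yz \<open>h z = h a\<close> by blast
      fix z' assume z': "z' \<in> fibre G h a \<and> list_mult G (us @ z' # vs) = y"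
      then have "U \<otimes>\<^bsub>G\<^esub> (z' \<otimes>\<^bsub>G\<^esub> V) = U \<otimes>\<^bsub>G\<^esub> (z \<otimes>\<^bsub>G\<^esub> V)"
        unfolding yz using eq[of z'] by (metis (mono_tags, lifting) mem_Collect_eq)
      then show "z' = z"
        using z' z UV by simp
    qed
  qed
  then show ?thesis
    unfolding nary_group_def
    using fibre_nary_semigroup[OF G.is_monoid homh a assms(3) pow] by blast
qed


section \<open>Fibres of ring homomorphisms\<close>

abbreviation (input) list_add :: "('a, 'b) ring_scheme \<Rightarrow> 'a list \<Rightarrow> 'a" where
  "list_add R xs \<equiv> foldr (\<oplus>\<^bsub>R\<^esub>) xs \<zero>\<^bsub>R\<^esub>"

context ring
begin

lemma list_add_closed: "set xs \<subseteq> carrier R \<Longrightarrow> list_add R xs \<in> carrier R"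
  by (induction xs) auto

lemma list_add_map_distrib:
  assumes "c \<in> carrier R" "d \<in> carrier R" "set ys \<subseteq> carrier R"
  shows "c \<otimes> (list_add R ys \<otimes> d) = list_add R (map (\<lambda>y. c \<otimes> (y \<otimes> d)) ys)"
  using assms(3)
proof (induction ys)
  case (Cons y ys)
  then show ?case
    using assms(1,2) by (simp add: list_add_closed l_distr r_distr)
qed (use assms in simp)

lemma polyadic_distributive_list:
  assumes "S \<subseteq> carrier R"
  shows "polyadic_distributive m n S (list_add R) (list_mult R)"
proof -
  have "list_mult R (us @ list_add R ys # vs) = list_add R (map (\<lambda>y. list_mult R (us @ y # vs)) ys)"
    if "set us \<subseteq> S" "set vs \<subseteq> S" "set ys \<subseteq> S" for us vs ys
  proof -
    have sub: "set us \<subseteq> carrier R" "set vs \<subseteq> carrier R" "set ys \<subseteq> carrier R"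
      using that assms by auto
    have eq: "list_mult R (us @ y # vs) = list_mult R us \<otimes> (y \<otimes> list_mult R vs)"
      if "y \<in> carrier R" for y
      using sub that by (simp add: list_mult_append del: foldr_append)
    have "map (\<lambda>y. list_mult R (us @ y # vs)) ys
        = map (\<lambda>y. list_mult R us \<otimes> (y \<otimes> list_mult R vs)) ys"
      using sub by (intro map_cong refl eq) auto
    then show ?thesis
      unfolding eq[OF list_add_closed[OF sub(3)]]
      using sub by (simp only: list_add_map_distrib multlist_closed)
  qed
  then show ?thesis
    unfolding polyadic_distributive_def by blast
qed

end

lemma fibre_polyadic_ring:
  assumes "ring_hom_ring R S h" "a \<in> carrier R" "m \<ge> 2" "n \<ge> 2"
    and "h ([m] \<cdot>\<^bsub>R\<^esub> a) = h a" "h (a [^]\<^bsub>R\<^esub> n) = h a"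
  shows "polyadic_ring m n (fibre R h a) (list_add R) (list_mult R)"
proof -
  interpret ring_hom_ring R S h by (rule assms(1))
  have "a \<in> carrier (add_monoid R)" "h (a [^]\<^bsub>add_monoid R\<^esub> m) = h a"
    using assms(2,5) by (simp_all only: add_pow_def partial_object.simps)
  from fibre_nary_group[OF a_group_hom this(1) assms(3) this(2)]
  have add: "nary_group m (fibre R h a) (list_add R)"
    by (simp only: partial_object.simps monoid.simps)
  have "fibre R h a \<subseteq> carrier (add_monoid R)"
    by auto
  from comm_monoid.nary_commutative_list_mult[OF R.a_comm_monoid this]
  have comm: "nary_commutative m (fibre R h a) (list_add R)"
    by (simp only: monoid.simps)
  have "h \<in> hom R S"
    using homh unfolding ring_hom_def hom_def by blast
  then have mult: "nary_semigroup n (fibre R h a) (list_mult R)"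
    using assms(2,4,6) by (intro fibre_nary_semigroup R.monoid_axioms)
  have dist: "polyadic_distributive m n (fibre R h a) (list_add R) (list_mult R)"
    by (rule R.polyadic_distributive_list) auto
  from add comm mult dist show ?thesis
    unfolding polyadic_ring_def by blast
qed


section \<open>Residue classes as fibres\<close>

text \<open>
  That \<open>x - a\<close> is a multiple of \<open>b\<close> means that \<open>x\<close> and \<open>a\<close> lie in the same coset of the principal
  ideal of \<open>b\<close>; so the ring homomorphism needed is the canonical projection \<open>x \<mapsto> PIdl b +> x\<close>.
\<close>

lemma (in cring) residue_class_eq_fibre:
  assumes a: "a \<in> carrier R" and b: "b \<in> carrier R"
  shows "{a \<oplus> b \<otimes> k |k. k \<in> carrier R} = fibre R ((+>) (PIdl b)) a"
proof -
  have I: "ideal (PIdl b) R"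
    using b by (rule cgenideal_ideal)
  have "x = a \<oplus> b \<otimes> k \<longleftrightarrow> x \<ominus> a = k \<otimes> b"
    if x: "x \<in> carrier R" and k: "k \<in> carrier R" for x k
  proof -
    have bk: "b \<otimes> k \<in> carrier R"
      using b k by (rule m_closed)
    have "x \<ominus> a = \<ominus> a \<oplus> x"
      unfolding a_minus_def by (rule a_comm[OF x a_inv_closed[OF a]])
    moreover have "\<ominus> a \<oplus> x = b \<otimes> k \<longleftrightarrow> x = a \<oplus> b \<otimes> k"
      using r_neg1[OF a bk] r_neg2[OF a x] by metis
    ultimately show ?thesis
      using m_comm[OF b k] by metis
  qed
  then have diff: "x \<ominus> a \<in> PIdl b \<longleftrightarrow> (\<exists>k. x = a \<oplus> b \<otimes> k \<and> k \<in> carrier R)"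
    if "x \<in> carrier R" for x
    using that unfolding cgenideal_def mem_Collect_eq by metis
  show ?thesis
  proof (intro Set.set_eqI iffI)
    fix x assume "x \<in> {a \<oplus> b \<otimes> k |k. k \<in> carrier R}"
    then obtain k where k: "x = a \<oplus> b \<otimes> k" "k \<in> carrier R"
      by blast
    then have x: "x \<in> carrier R"
      by (simp only: a b a_closed m_closed)
    show "x \<in> fibre R ((+>) (PIdl b)) a"
      using x k diff[OF x] quotient_eq_iff_same_a_r_cos[OF I x a] by blast
  next
    fix x assume "x \<in> fibre R ((+>) (PIdl b)) a"
    then have x: "x \<in> carrier R" and "PIdl b +> x = PIdl b +> a"
      by blast+
    then show "x \<in> {a \<oplus> b \<otimes> k |k. k \<in> carrier R}"
      using diff[OF x] quotient_eq_iff_same_a_r_cos[OF I x a] by blast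
  qed
qed

theorem theorem4p6:
  fixes p m n :: nat and a b :: "nat \<Rightarrow> int"
  assumes "prime p" and "m \<ge> 2" and "n \<ge> 2"
    and "a \<in> carrier (padic_int p)" and "b \<in> carrier (padic_int p)"
    and "comp_le p \<zero>\<^bsub>padic_int p\<^esub> a" and "comp_less p a b"
    and "padic_mod_eq p ([m] \<cdot>\<^bsub>padic_int p\<^esub> a) a b"
    and "padic_mod_eq p (a [^]\<^bsub>padic_int p\<^esub> n) a b"
  shows "polyadic_ring m n (padic_residue_class p a b) (padic_sum p) (padic_prod p)"
proof -
  interpret cring "padic_int p"
    using assms(1) by (intro cring_padic_int prime_gt_0_nat)
  let ?h = "(+>\<^bsub>padic_int p\<^esub>) (PIdl\<^bsub>padic_int p\<^esub> b)"
  have "ring_hom_ring (padic_int p) (padic_int p Quot PIdl\<^bsub>padic_int p\<^esub> b) ?h"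
    using assms(5) by (intro ideal.rcos_ring_hom_ring cgenideal_ideal)
  moreover have class_eq: "padic_residue_class p a b = fibre (padic_int p) ?h a"
    unfolding padic_residue_class_def using assms(4,5) by (rule residue_class_eq_fibre)
  moreover have "?h r = ?h a" if "padic_mod_eq p r a b" for r
    using that class_eq unfolding padic_residue_class_def padic_mod_eq_def by blast
  ultimately show ?thesis
    using fibre_polyadic_ring[of "padic_int p" _ ?h a m n] assms
    unfolding padic_sum_def padic_prod_def by simp
qed

end
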